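(* Let $\Delta$ be a simplicial complex on $[n]$. Then the following conditions are equivalent: (i) the algebra $B(\Gamma)$ is standard graded for all subcomplexes $\Gamma\subseteq\Delta$; (ii) the vertex cover algebra $A(\Gamma)$ is standard graded for all subcomplexes $\Gamma\subseteq\Delta$; (iii) $\Delta$ has no special odd cycles.
   Context: Let $K$ be a field, $[n]=\{1,\ldots,n\}$ and $S=K[x_1,\ldots,x_n]$. A simplicial complex on $[n]$ is a nonempty collection of subsets (faces) of $[n]$ closed under taking subsets; facets are maximal faces, and $\mathcal{F}(\Delta)$ is the set of facets. In this statement a subcomplex $\Gamma\subseteq\Delta$ means a simplicial complex with $\mathcal{F}(\Gamma)\subseteq\mathcal{F}(\Delta)$. A cycle of length $r\ge 2$ of $\Delta$ is a sequence $i_1,F_1,i_2,F_2,\ldots,i_r,F_r,i_{r+1}=i_1$ with $i_1,\ldots,i_r\in[n]$ distinct, $F_1,\ldots,F_r\in\mathcal{F}(\Delta)$ distinct, and $i_j,i_{j+1}\in F_j$ for $j=1,\ldots,r$. A cycle is odd if $r$ is odd, and special if each facet $F_j$ of the cycle contains exactly two of the vertices $i_1,\ldots,i_r$. For $k\ge 0$, a $k$-cover of a simplicial complex $\Gamma$ on $[n]$ is a nonzero vector $c\in\mathbb{Z}_{\ge 0}^n$ with $\sum_{i\in F}c_i\ge k$ for every facet $F$ of $\Gamma$; it is squarefree if all $c_i\le 1$. Write $x^c=x_1^{c_1}\cdots x_n^{c_n}$. For $k\ge 1$, $J_k(\Gamma)\subseteq S$ is the ideal spanned over $K$ by the monomials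 $x^c$ with $c$ a $k$-cover, $J_0(\Gamma)=S$, and $A(\Gamma)=\bigoplus_{k\ge 0}J_k(\Gamma)t^k\subseteq S[t]$. $B(\Gamma)\subseteq S[t]$ is the $S$-subalgebra generated by all $x^ct^k$ with $k\ge 1$ and $c$ a squarefree $k$-cover of $\Gamma$. Both algebras are graded by the degree in $t$ (so $S$ is in degree $0$); such an algebra is standard graded if it is generated as an $S$-algebra by its elements of degree $1$. *)

theory Defs
  imports
    "HOL-Library.Poly_Mapping"
    "HOL-Computational_Algebra.Polynomial"
begin

section \<open>Simplicial complexes on \<open>{1..n}\<close>\<close>

definition simplicial_complex :: "nat \<Rightarrow> nat set set \<Rightarrow> bool" where
  "simplicial_complex n \<Delta> \<longleftrightarrow>
     \<Delta> \<noteq> {} \<and> \<Delta> \<subseteq> Pow {1..n} \<and> (\<forall>F\<in>\<Delta>. \<forall>G. G \<subseteq> F \<longrightarrow> G \<in> \<Delta>)"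

definition facets :: "nat set set \<Rightarrow> nat set set" where
  "facets \<Delta> = {F \<in> \<Delta>. \<forall>G\<in>\<Delta>. F \<subseteq> G \<longrightarrow> G = F}"

text \<open>A subcomplex is spanned by facets of the larger complex; arbitrary subsets of \<open>\<Delta>\<close>
  that happen to be simplicial complexes do not qualify.\<close>

definition subcomplex :: "nat \<Rightarrow> nat set set \<Rightarrow> nat set set \<Rightarrow> bool" where
  "subcomplex n \<Gamma> \<Delta> \<longleftrightarrow> simplicial_complex n \<Gamma> \<and> facets \<Gamma> \<subseteq> facets \<Delta>"

text \<open>The sequence \<open>i\<^sub>1, F\<^sub>1, \<dots>, i\<^sub>r, F\<^sub>r, i\<^sub>r\<^sub>+\<^sub>1 = i\<^sub>1\<close> is given by two functions, of which only
  the values \<open>i j\<close> for \<open>1 \<le> j \<le> r + 1\<close> and \<open>F j\<close> for \<open>1 \<le> j \<le> r\<close> matter.\<close>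

definition is_cycle ::
    "nat \<Rightarrow> nat set set \<Rightarrow> nat \<Rightarrow> (nat \<Rightarrow> nat) \<Rightarrow> (nat \<Rightarrow> nat set) \<Rightarrow> bool" where
  "is_cycle n \<Delta> r i F \<longleftrightarrow>
     r \<ge> 2 \<and>
     i ` {1..r} \<subseteq> {1..n} \<and> inj_on i {1..r} \<and> i (r + 1) = i 1 \<and>
     F ` {1..r} \<subseteq> facets \<Delta> \<and> inj_on F {1..r} \<and>
     (\<forall>j\<in>{1..r}. i j \<in> F j \<and> i (j + 1) \<in> F j)"

definition special_cycle ::
    "nat \<Rightarrow> nat set set \<Rightarrow> nat \<Rightarrow> (nat \<Rightarrow> nat) \<Rightarrow> (nat \<Rightarrow> nat set) \<Rightarrow> bool" where
  "special_cycle n \<Delta> r i F \<longleftrightarrow>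
     is_cycle n \<Delta> r i F \<and> (\<forall>j\<in>{1..r}. card (F j \<inter> i ` {1..r}) = 2)"


section \<open>Covers\<close>

text \<open>A vector in \<open>\<int>\<^sub>\<ge>\<^sub>0\<^sup>n\<close> is a finitely supported function with support in \<open>{1..n}\<close>, so that it
  is at the same time an exponent vector of a monomial in \<open>x\<^sub>1, \<dots>, x\<^sub>n\<close>.\<close>

definition is_cover :: "nat \<Rightarrow> nat set set \<Rightarrow> nat \<Rightarrow> (nat \<Rightarrow>\<^sub>0 nat) \<Rightarrow> bool" where
  "is_cover n \<Gamma> k c \<longleftrightarrow>
     Poly_Mapping.keys c \<subseteq> {1..n} \<and> c \<noteq> 0 \<and>
     (\<forall>F\<in>facets \<Gamma>. (\<Sum>i\<in>F. Poly_Mapping.lookup c i) \<ge> k)"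

definition squarefree_cover :: "nat \<Rightarrow> nat set set \<Rightarrow> nat \<Rightarrow> (nat \<Rightarrow>\<^sub>0 nat) \<Rightarrow> bool" where
  "squarefree_cover n \<Gamma> k c \<longleftrightarrow> is_cover n \<Gamma> k c \<and> (\<forall>i. Poly_Mapping.lookup c i \<le> 1)"


section \<open>The polynomial rings \<open>S = K[x\<^sub>1, \<dots>, x\<^sub>n]\<close> and \<open>S[t]\<close>\<close>

text \<open>The type \<open>'k mpoly\<close> has a variable for every natural number;
  \<open>S\<close> is its subring \<open>poly_ring n\<close>, and \<open>S[t]\<close> lies in the type \<open>'k mpoly poly\<close>.\<close>

type_synonym 'k mpoly = "(nat \<Rightarrow>\<^sub>0 nat) \<Rightarrow>\<^sub>0 'k"

definition poly_ring :: "nat \<Rightarrow> 'k::field mpoly set" where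
  "poly_ring n = {p. \<forall>m\<in>Poly_Mapping.keys p. Poly_Mapping.keys m \<subseteq> {1..n}}"

definition xpow :: "(nat \<Rightarrow>\<^sub>0 nat) \<Rightarrow> 'k::field mpoly" where
  "xpow c = Poly_Mapping.single c 1"

lemma xpow_eq_prod_variables:
  assumes "Poly_Mapping.keys c \<subseteq> {1..n}"
  shows "xpow c = (\<Prod>i = 1..n. xpow (Poly_Mapping.single i 1) ^ Poly_Mapping.lookup c i)"
proof -
  have pow: "xpow d ^ k = (xpow (\<Sum>_ = 1..k. d) :: 'a mpoly)" for d k
    by (induction k) (simp_all add: xpow_def mult_single add.commute del: sum_constant)
  have sing: "(\<Sum>_ = 1..k. Poly_Mapping.single i (1::nat)) = Poly_Mapping.single i k" for i k
    by (induction k) (simp_all add: single_add [symmetric] del: sum_constant)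
  have prod: "(\<Prod>i\<in>A. xpow (g i)) = (xpow (\<Sum>i\<in>A. g i) :: 'a mpoly)" if "finite A"
    for A :: "nat set" and g
    using that by (induction) (simp_all add: xpow_def mult_single)
  have "c = (\<Sum>i = 1..n. Poly_Mapping.single i (Poly_Mapping.lookup c i))"
  proof (rule poly_mapping_eqI)
    fix j
    have "Poly_Mapping.lookup c j = 0" if "j \<notin> {1..n}"
      using assms that by (meson in_keys_iff subsetD)
    then show "Poly_Mapping.lookup c j =
        Poly_Mapping.lookup (\<Sum>i = 1..n. Poly_Mapping.single i (Poly_Mapping.lookup c i)) j"
      by (auto simp: lookup_sum lookup_single when_def)
  qed
  then show ?thesis
    by (simp only: pow sing prod finite_atLeastAtMost)
qed

definition mpoly_scale :: "'k::field \<Rightarrow> 'k mpoly \<Rightarrow> 'k mpoly" where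
  "mpoly_scale a p = Poly_Mapping.single 0 a * p"

global_interpretation mpoly: vector_space mpoly_scale
  by standard
    (simp_all add: mpoly_scale_def distrib_left distrib_right single_add mult_single
      mult.assoc [symmetric])

definition t_poly_ring :: "nat \<Rightarrow> 'k::field mpoly poly set" where
  "t_poly_ring n = {f. \<forall>k. coeff f k \<in> poly_ring n}"

text \<open>An \<open>S\<close>-subalgebra of \<open>S[t]\<close> contains \<open>S\<close>, hence also 0, 1 and all negatives.\<close>

definition S_subalgebra :: "nat \<Rightarrow> 'k::field mpoly poly set \<Rightarrow> bool" where
  "S_subalgebra n R \<longleftrightarrow>
     R \<subseteq> t_poly_ring n \<and> (\<forall>s\<in>poly_ring n. [:s:] \<in> R) \<and>
     (\<forall>f\<in>R. \<forall>g\<in>R. f + g \<in> R \<and> f * g \<in> R)"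

text \<open>For \<open>G \<subseteq> S[t]\<close>, the \<open>S\<close>-subalgebra of \<open>S[t]\<close> generated by \<open>G\<close> is
  \<open>S_subalgebra n hull G\<close>.  The notion below is meant for subalgebras \<open>R\<close> of \<open>S[t]\<close> that are
  graded by the degree in \<open>t\<close>; \<open>monom s 1\<close> is \<open>s t\<close>.\<close>

definition standard_graded :: "nat \<Rightarrow> 'k::field mpoly poly set \<Rightarrow> bool" where
  "standard_graded n R \<longleftrightarrow> R = S_subalgebra n hull {f \<in> R. \<exists>s. f = monom s 1}"


section \<open>The algebras \<open>A(\<Gamma>)\<close> and \<open>B(\<Gamma>)\<close>\<close>

definition cover_ideal :: "nat \<Rightarrow> nat set set \<Rightarrow> nat \<Rightarrow> 'k::field mpoly set" where
  "cover_ideal n \<Gamma> k =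
     (if k = 0 then poly_ring n else mpoly.span {xpow c | c. is_cover n \<Gamma> k c})"

definition vertex_cover_algebra :: "nat \<Rightarrow> nat set set \<Rightarrow> 'k::field mpoly poly set" where
  "vertex_cover_algebra n \<Gamma> = {f. \<forall>k. coeff f k \<in> cover_ideal n \<Gamma> k}"

definition squarefree_cover_algebra :: "nat \<Rightarrow> nat set set \<Rightarrow> 'k::field mpoly poly set" where
  "squarefree_cover_algebra n \<Gamma> =
     S_subalgebra n hull {monom (xpow c) k | c k. k \<ge> 1 \<and> squarefree_cover n \<Gamma> k c}"

end

theory Submission
  imports Defs
begin

text \<open>
  The monomials \<open>x\<^sup>c t\<^sup>k\<close> of \<open>A(\<Gamma>)\<close> are given by the pairs \<open>(c, k)\<close> with \<open>c\<close> a \<open>k\<close>-cover, and those of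
  the subalgebra generated in degree one by the pairs for which \<open>c\<close> is a sum of \<open>k\<close> covers of order
  one plus some further vector.  So \<open>A(\<Gamma>)\<close> is standard graded as soon as every \<open>k\<close>-cover decomposes in
  this way.  The same decomposition serves \<open>B(\<Gamma>)\<close>, because the summands of a squarefree vector are
  squarefree.

  Suppose that there are no special odd cycles, which is to say that the facets form a balanced
  hypergraph in the sense of Berge.  Take \<open>c\<^sub>i\<close> copies of each vertex \<open>i\<close>.  The facets become sets of
  at least \<open>k\<close> elements and remain balanced (\<open>balanced_replication\<close>).  Berge's theorem
  (\<open>balanced_good_colouring\<close>) colours the copies with \<open>k\<close> colours in such a way that every colour
  occurs in every facet; each colour class then is a cover of order one, and the classes add up
  to \<open>c\<close>.  Berge's theorem reduces to two colours, since a defective colouring improves when the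
  vertices of two suitable colours are coloured afresh.  The two-colouring itself
  (\<open>balanced_two_colouring\<close>) is an induction on the vertex set: remove the end of a longest path in
  the graph of all two-element traces; its neighbours lie on that path and, in the absence of odd
  cycles, all have the same colour, which leaves the other colour for the removed vertex.

  Conversely, let \<open>\<Gamma>\<close> be spanned by the facets of a special odd cycle of length \<open>r\<close>.  The
  indicator vector of the vertices of the cycle is a squarefree cover of order two, of total
  weight \<open>r\<close>.  Each vertex of the cycle belongs to two of its facets, so a cover of order one
  supported on the cycle has weight at least \<open>r / 2\<close>, hence more than \<open>r / 2\<close> as \<open>r\<close> is odd,
  and two of them do not fit below the indicator vector
  (\<open>odd_special_cycle_indecomposable\<close>).  Its monomial therefore lies in \<open>B(\<Gamma>) \<subseteq> A(\<Gamma>)\<close>, but not in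
  the subalgebra generated in degree one by either of them.
\<close>

section \<open>Colouring balanced set systems\<close>

text \<open>The condition on \<open>F j\<close> combines membership of \<open>i j\<close> and \<open>i (j + 1)\<close> with speciality.  For
  \<open>r \<ge> 3\<close> it also makes the sets \<open>F j\<close> distinct.\<close>

definition balanced :: "'a set set \<Rightarrow> bool" where
  "balanced E \<longleftrightarrow>
     \<not> (\<exists>(r::nat) i F. odd r \<and> r \<ge> 3 \<and> inj_on i {1..r} \<and> i (r + 1) = i 1 \<and>
          (\<forall>j\<in>{1..r}. F j \<in> E \<and> F j \<inter> i ` {1..r} = {i j, i (j + 1)}))"

text \<open>Colouring inside an arbitrary finite set \<open>W\<close> of vertices is what makes the induction work: the
  traces \<open>F \<inter> W\<close> of a balanced family carry no odd special cycle either, since a special cycle with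
  vertices in \<open>W\<close> only sees these traces.\<close>

lemma balanced_two_colouring:
  assumes "balanced E" and "finite W"
  shows "\<exists>g :: 'a \<Rightarrow> bool. \<forall>F\<in>E. card (F \<inter> W) \<ge> 2 \<longrightarrow> g ` (F \<inter> W) = UNIV"
  using assms(2)
proof (induction W rule: finite_psubset_induct)
  case (psubset W)
  \<comment> \<open>The traces of size two are the edges of a graph on \<open>W\<close>, which any valid colouring has to colour
    properly.  Larger traces that contain the removed vertex stay two-coloured by themselves.\<close>
  define adj where "adj u v \<longleftrightarrow> u \<noteq> v \<and> (\<exists>F\<in>E. F \<inter> W = {u, v})" for u v
  define path where
    "path p \<longleftrightarrow> distinct p \<and> set p \<subseteq> W \<and> (\<forall>s. Suc s < length p \<longrightarrow> adj (p ! s) (p ! Suc s))" for p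
  show ?case
  proof (cases "W = {}")
    case True
    then show ?thesis by simp
  next
    case False
    then obtain w where "w \<in> W" by blast
    then have "path [w]" by (simp add: path_def)
    moreover have "\<forall>p. path p \<longrightarrow> length p < Suc (card W)"
      using psubset.hyps by (metis path_def card_mono distinct_card le_imp_less_Suc)
    ultimately have "\<exists>p. path p \<and> (\<forall>q. path q \<longrightarrow> length q \<le> length p)"
      by (rule ex_has_greatest_nat)
    then obtain p where p: "path p" and longest: "\<And>q. path q \<Longrightarrow> length q \<le> length p"
      by blast
    have "p \<noteq> []" using longest[OF \<open>path [w]\<close>] by auto
    define v where "v = p ! 0"
    have "v \<in> W" using p \<open>p \<noteq> []\<close> by (auto simp: v_def path_def)
    then have "W - {v} \<subset> W" by blast
    \<comment> \<open>Colour everything but the end \<open>v\<close> of a longest path, and choose the colour of \<open>v\<close> at the end.\<close>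
    from psubset.IH[OF this] obtain g :: "'a \<Rightarrow> bool" where
      g: "\<And>F. F \<in> E \<Longrightarrow> card (F \<inter> (W - {v})) \<ge> 2 \<Longrightarrow> g ` (F \<inter> (W - {v})) = UNIV"
      by blast
    have g_adj: "g y = (\<not> g x)" if xy: "adj x y" "x \<noteq> v" "y \<noteq> v" for x y
    proof -
      obtain F where F: "F \<in> E" "F \<inter> W = {x, y}" "x \<noteq> y" using xy(1) by (auto simp: adj_def)
      have "F \<inter> (W - {v}) = {x, y}" using F(2) xy(2,3) by blast
      then have "g ` {x, y} = UNIV" using g[OF F(1)] F(3) by simp
      then have "True \<in> {g x, g y}" "False \<in> {g x, g y}" by auto
      then show ?thesis by auto
    qed
    have not_v: "p ! s \<noteq> v" if "0 < s" "s < length p" for s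
      using p that nth_eq_iff_index_eq[of p s 0] \<open>p \<noteq> []\<close> by (auto simp: v_def path_def)
    have alternate: "g (p ! Suc s) = (g (p ! 1) = even s)" if "Suc s < length p" for s
      using that
    proof (induction s)
      case (Suc s)
      have "adj (p ! Suc s) (p ! Suc (Suc s))" using p Suc.prems by (auto simp: path_def)
      then have "g (p ! Suc (Suc s)) = (\<not> g (p ! Suc s))"
        by (rule g_adj) (use not_v Suc.prems in auto)
      then show ?case using Suc by auto
    qed simp
    have nbr: "g u = g (p ! 1)" if u: "adj v u" for u
    proof -
      have "u \<in> W" "u \<noteq> v" using u by (auto simp: adj_def)
      \<comment> \<open>Otherwise \<open>u\<close> would prolong the path.\<close>
      have "u \<in> set p"
      proof (rule ccontr)
        assume "u \<notin> set p"
        have "adj ((u # p) ! s) ((u # p) ! Suc s)" if "Suc s < length (u # p)" for s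
        proof (cases s)
          case 0
          then show ?thesis using u by (auto simp: adj_def v_def insert_commute)
        next
          case (Suc s')
          then show ?thesis using p that by (auto simp: path_def)
        qed
        then have "path (u # p)"
          using p \<open>u \<notin> set p\<close> \<open>u \<in> W\<close> by (simp add: path_def)
        then show False using longest[of "u # p"] by simp
      qed
      then obtain a where a: "a < length p" "u = p ! a" by (auto simp: in_set_conv_nth)
      have "a \<noteq> 0" using a \<open>u \<noteq> v\<close> by (auto simp: v_def intro: ccontr)
      \<comment> \<open>The edge from \<open>u\<close> back to \<open>v\<close> closes the initial segment of the path to a cycle of length
        \<open>a + 1\<close>, and for even \<open>a\<close> this would be an odd special cycle.\<close>
      have "odd a"
      proof (rule ccontr)
        assume "\<not> odd a"
        define r where "r = Suc a"
        define i where "i j = (if j = r + 1 then v else p ! (j - 1))" for j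
        have r: "odd r" "r \<ge> 3" using \<open>\<not> odd a\<close> \<open>a \<noteq> 0\<close> by (auto simp: r_def elim: evenE)
        have "p ! (j - 1) \<in> W" if "j \<in> {1..r}" for j
          using p a that nth_mem[of "j - 1" p] by (auto simp: path_def r_def)
        then have inW: "i ` {1..r} \<subseteq> W" by (auto simp: i_def)
        have inj: "inj_on i {1..r}"
        proof (rule inj_onI)
          fix x y assume xy: "x \<in> {1..r}" "y \<in> {1..r}" "i x = i y"
          then have "p ! (x - 1) = p ! (y - 1)" by (simp add: i_def)
          then have "x - 1 = y - 1"
            using p a xy nth_eq_iff_index_eq[of p "x - 1" "y - 1"]
            by (auto simp: path_def r_def)
          then show "x = y" using xy by auto
        qed
        have "\<exists>F. F \<in> E \<and> F \<inter> W = {i j, i (j + 1)}" if j: "j \<in> {1..r}" for j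
        proof (cases "j = r")
          case True
          then have "i j = u" "i (j + 1) = v" using a by (auto simp: i_def r_def)
          then show ?thesis using u by (auto simp: adj_def insert_commute)
        next
          case False
          then have "adj (p ! (j - 1)) (p ! Suc (j - 1))"
            using p a j False by (cases j) (auto simp: path_def r_def)
          moreover have "i j = p ! (j - 1)" "i (j + 1) = p ! Suc (j - 1)"
            using False j by (auto simp: i_def)
          ultimately show ?thesis by (auto simp: adj_def)
        qed
        then obtain F where F: "\<And>j. j \<in> {1..r} \<Longrightarrow> F j \<in> E \<and> F j \<inter> W = {i j, i (j + 1)}"
          by metis
        have close: "i (r + 1) = i 1" using r by (simp add: i_def v_def)
        have "F j \<in> E \<and> F j \<inter> i ` {1..r} = {i j, i (j + 1)}" if j: "j \<in> {1..r}" for j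
        proof -
          have "i (j + 1) \<in> i ` {1..r}"
          proof (cases "j = r")
            case True
            have "i 1 \<in> i ` {1..r}" using r by auto
            then show ?thesis using close True by simp
          next
            case False
            then show ?thesis using j by auto
          qed
          then have "F j \<inter> i ` {1..r} = {i j, i (j + 1)}" using F[OF j] inW j by blast
          then show ?thesis using F[OF j] by blast
        qed
        then have "\<not> balanced E"
          unfolding balanced_def not_not
          by (intro exI[of _ r] exI[of _ i] exI[of _ F] conjI ballI r inj close) simp_all
        then show False using assms(1) by blast
      qed
      then obtain s where s: "a = Suc s" "even s" by (cases a) auto
      then show ?thesis using alternate[of s] a by simp
    qed
    define h where "h x = (if x = v then \<not> g (p ! 1) else g x)" for x
    have "h ` (F \<inter> W) = UNIV" if F: "F \<in> E" "card (F \<inter> W) \<ge> 2" for F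
    proof (cases "card (F \<inter> (W - {v})) \<ge> 2")
      case True
      have "h ` (F \<inter> (W - {v})) = g ` (F \<inter> (W - {v}))"
        by (rule image_cong) (auto simp: h_def)
      then have "h ` (F \<inter> (W - {v})) = UNIV" using g[OF F(1) True] by (rule trans)
      moreover have "h ` (F \<inter> (W - {v})) \<subseteq> h ` (F \<inter> W)" by (rule image_mono) auto
      ultimately show ?thesis by (simp add: top.extremum_unique)
    next
      case False
      have eq: "F \<inter> (W - {v}) = F \<inter> W - {v}" by blast
      have "v \<in> F \<inter> W"
      proof (rule ccontr)
        assume "v \<notin> F \<inter> W"
        then have "F \<inter> (W - {v}) = F \<inter> W" by blast
        then show False using False F by simp
      qed
      then have "card (F \<inter> W - {v}) = 1"
        using False F psubset.hyps eq by (simp add: card_Diff_singleton)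
      then obtain u where u: "F \<inter> W - {v} = {u}" by (auto simp: card_1_singleton_iff)
      then have FW: "F \<inter> W = {v, u}" and "u \<noteq> v" using \<open>v \<in> F \<inter> W\<close> by auto
      then have "adj v u" using F by (auto simp: adj_def)
      then have "h u = (\<not> h v)" using nbr \<open>u \<noteq> v\<close> by (simp add: h_def)
      then show ?thesis using FW by (auto simp: UNIV_bool)
    qed
    then show ?thesis by blast
  qed
qed

text \<open>Berge's theorem.  A colouring that maximises the total number of colours seen by the members of
  \<open>E\<close> has the required property: if a large member \<open>F0\<close> misses the colour \<open>q\<close>, some colour \<open>p\<close> occurs
  twice in it, and a two-colouring of the vertices of colours \<open>p\<close> and \<open>q\<close> gives a better
  colouring.\<close>

lemma balanced_good_colouring:
  assumes "balanced E" and "finite E" and "finite V"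
  shows "\<exists>f. \<forall>F\<in>E. card (F \<inter> V) \<ge> k \<longrightarrow> {..<k} \<subseteq> f ` (F \<inter> V)"
proof (cases "k = 0")
  case True
  then show ?thesis by simp
next
  case False
  define colours :: "('a \<Rightarrow> nat) \<Rightarrow> nat" where "colours f = (\<Sum>F\<in>E. card (f ` (F \<inter> V)))" for f
  define ok :: "('a \<Rightarrow> nat) \<Rightarrow> bool" where "ok f \<longleftrightarrow> f ` V \<subseteq> {..<k}" for f
  have "ok (\<lambda>_. 0)" using False by (auto simp: ok_def)
  moreover have "\<forall>f. ok f \<longrightarrow> colours f < Suc (card E * card V)"
  proof (intro allI impI)
    fix f assume "ok f"
    have "card (f ` (F \<inter> V)) \<le> card V" for F
      by (meson assms(3) card_image_le card_mono inf_le2 le_trans finite_Int)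
    then have "colours f \<le> card E * card V"
      unfolding colours_def using sum_bounded_above[of E _ "card V"] by simp
    then show "colours f < Suc (card E * card V)" by simp
  qed
  ultimately have "\<exists>f. ok f \<and> (\<forall>f'. ok f' \<longrightarrow> colours f' \<le> colours f)"
    by (rule ex_has_greatest_nat)
  then obtain f where f: "ok f" and best: "\<And>f'. ok f' \<Longrightarrow> colours f' \<le> colours f"
    by blast
  have "q \<in> f ` (F0 \<inter> V)" if F0: "F0 \<in> E" "card (F0 \<inter> V) \<ge> k" and q: "q < k" for F0 q
  proof (rule ccontr)
    assume miss: "q \<notin> f ` (F0 \<inter> V)"
    have "f ` (F0 \<inter> V) \<subseteq> {..<k} - {q}" using f miss by (auto simp: ok_def)
    then have "card (f ` (F0 \<inter> V)) \<le> card ({..<k} - {q})" by (rule card_mono[rotated]) simp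
    also have "\<dots> < k" using q by simp
    finally have "\<not> inj_on f (F0 \<inter> V)" using F0(2) by (auto dest: card_image)
    then obtain x y where xy: "x \<in> F0 \<inter> V" "y \<in> F0 \<inter> V" "x \<noteq> y" "f x = f y"
      by (auto simp: inj_on_def)
    define p where "p = f x"
    have pq: "p \<noteq> q" "p < k" using miss xy f by (auto simp: p_def ok_def)
    define W where "W = {v \<in> V. f v = p \<or> f v = q}"
    have W: "finite W" "W \<subseteq> V" using assms(3) by (auto simp: W_def)
    obtain g :: "'a \<Rightarrow> bool" where
      g: "\<And>F. F \<in> E \<Longrightarrow> card (F \<inter> W) \<ge> 2 \<Longrightarrow> g ` (F \<inter> W) = UNIV"
      using balanced_two_colouring[OF assms(1) W(1)] by blast
    define f' where "f' v = (if v \<in> W then if g v then p else q else f v)" for v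
    have "ok f'" using f pq q by (auto simp: ok_def f'_def)
    have two: "f' ` (F \<inter> W) = {p, q}" if "F \<in> E" "card (F \<inter> W) \<ge> 2" for F
    proof -
      have "f' ` (F \<inter> W) = (\<lambda>b. if b then p else q) ` (g ` (F \<inter> W))"
        unfolding image_image by (rule image_cong) (auto simp: f'_def)
      then show ?thesis by (simp add: g[OF that] UNIV_bool insert_commute)
    qed
    have split: "card (h ` (F \<inter> V)) = card (h ` (F \<inter> W)) + card (f ` (F \<inter> (V - W)))"
      if h: "\<And>v. v \<in> W \<Longrightarrow> h v \<in> {p, q}" "\<And>v. v \<notin> W \<Longrightarrow> h v = f v" for h F
    proof -
      have "h ` (F \<inter> (V - W)) = f ` (F \<inter> (V - W))" by (rule image_cong) (use h in auto)
      then have "h ` (F \<inter> V) = h ` (F \<inter> W) \<union> f ` (F \<inter> (V - W))" using W(2) by blast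
      moreover have "h ` (F \<inter> W) \<inter> f ` (F \<inter> (V - W)) = {}"
      proof -
        have "h a \<noteq> f b" if "a \<in> F \<inter> W" "b \<in> F \<inter> (V - W)" for a b
          using h(1)[of a] that by (auto simp: W_def)
        then show ?thesis by blast
      qed
      ultimately show ?thesis using assms(3) W(1) by (simp add: card_Un_disjoint)
    qed
    have split_f: "card (f ` (F \<inter> V)) = card (f ` (F \<inter> W)) + card (f ` (F \<inter> (V - W)))" for F
      by (rule split) (auto simp: W_def)
    have split_f': "card (f' ` (F \<inter> V)) = card (f' ` (F \<inter> W)) + card (f ` (F \<inter> (V - W)))" for F
      by (rule split) (auto simp: f'_def)
    \<comment> \<open>No member loses a colour: one that meets \<open>W\<close> in two or more vertices now has both \<open>p\<close> and \<open>q\<close>,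
      the others have as many colours on \<open>W\<close> as vertices there, namely at most one.\<close>
    have le: "card (f ` (F \<inter> V)) \<le> card (f' ` (F \<inter> V))" if "F \<in> E" for F
    proof (cases "card (F \<inter> W) \<ge> 2")
      case True
      have "card (f ` (F \<inter> W)) \<le> card {p, q}" by (rule card_mono) (auto simp: W_def)
      then show ?thesis unfolding split_f split_f' two[OF that True] by simp
    next
      case False
      then have "is_singleton (F \<inter> W) \<or> F \<inter> W = {}"
        using W(1) by (auto simp: is_singleton_altdef less_2_cases_iff not_le)
      then have "card (f ` (F \<inter> W)) = card (f' ` (F \<inter> W))" by (auto elim!: is_singletonE)
      then show ?thesis unfolding split_f split_f' by simp
    qed
    have "card (f ` (F0 \<inter> V)) < card (f' ` (F0 \<inter> V))"
    proof -
      have "x \<in> F0 \<inter> W" "y \<in> F0 \<inter> W" using xy by (auto simp: W_def p_def)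
      then have "card {x, y} \<le> card (F0 \<inter> W)" using W(1) by (intro card_mono) auto
      then have two': "f' ` (F0 \<inter> W) = {p, q}" using two[OF F0(1)] xy(3) by simp
      have "f ` (F0 \<inter> W) \<subseteq> {p}" using miss W(2) by (auto simp: W_def)
      then have "card (f ` (F0 \<inter> W)) \<le> card {p}" by (rule card_mono[rotated]) simp
      then show ?thesis unfolding split_f split_f' two' using pq by simp
    qed
    then have "colours f < colours f'"
      unfolding colours_def using le F0(1) assms(2) by (intro sum_strict_mono_ex1) auto
    then show False using best[OF \<open>ok f'\<close>] by simp
  qed
  then show ?thesis by blast
qed

text \<open>Replacing each vertex by copies creates no odd special cycle.  Two copies of a vertex lie in
  the same members, so if both occurred in a special cycle, they would be neighbours on it on
  either side, and the cycle would have length two.\<close>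

lemma balanced_replication:
  fixes E :: "'a set set"
  assumes "balanced E"
  shows "balanced ((\<lambda>F. fst -` F :: ('a \<times> 'b) set) ` E)"
proof (rule ccontr)
  assume "\<not> balanced ((\<lambda>F. fst -` F :: ('a \<times> 'b) set) ` E)"
  then obtain r and i :: "nat \<Rightarrow> 'a \<times> 'b" and F' where
    r: "odd r" "r \<ge> 3" and inj: "inj_on i {1..r}" and close: "i (r + 1) = i 1"
    and cycle: "\<forall>j\<in>{1..r}. F' j \<in> (\<lambda>F. fst -` F) ` E \<and> F' j \<inter> i ` {1..r} = {i j, i (j + 1)}"
    unfolding balanced_def not_not by (elim exE conjE) (rule that; assumption)
  have F': "F' j \<in> (\<lambda>F. fst -` F) ` E" "F' j \<inter> i ` {1..r} = {i j, i (j + 1)}"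
    if "j \<in> {1..r}" for j
    using bspec[OF cycle that] by (rule conjunct1, rule conjunct2)
  have "\<exists>F. F \<in> E \<and> F' j = fst -` F" if "j \<in> {1..r}" for j
    using F'(1)[OF that] by (auto elim!: imageE)
  then obtain F where F: "\<And>j. j \<in> {1..r} \<Longrightarrow> F j \<in> E \<and> F' j = fst -` F j"
    by metis
  have eqD: "a = b" if "i a = i b" "a \<in> {1..r}" "b \<in> {1..r}" for a b
    using inj_onD[OF inj that] .
  have no_copies: False if "a < b" "a \<in> {1..r}" "b \<in> {1..r}" "fst (i a) = fst (i b)" for a b
  proof -
    have "i a \<in> F' a" "i b \<in> F' b" using F'(2) that by blast+
    then have "i b \<in> F' a" "i a \<in> F' b" using F that by auto
    then have "i b \<in> {i a, i (a + 1)}" "i a \<in> {i b, i (b + 1)}" using F'(2) that by blast+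
    then have "b = a + 1" and ab: "i a = i (b + 1)"
      using eqD[of b a] eqD[of b "a + 1"] eqD[of a b] that by auto
    then show False
      using eqD[of a "b + 1"] eqD[of a 1] close r that by (cases "b = r") auto
  qed
  have "inj_on (fst \<circ> i) {1..r}"
  proof (rule inj_onI)
    fix a b assume "a \<in> {1..r}" "b \<in> {1..r}" "(fst \<circ> i) a = (fst \<circ> i) b"
    then show "a = b" using no_copies[of a b] no_copies[of b a] by (cases a b rule: linorder_cases) auto
  qed
  moreover have "\<forall>j\<in>{1..r}. F j \<in> E \<and> F j \<inter> (fst \<circ> i) ` {1..r} = {(fst \<circ> i) j, (fst \<circ> i) (j + 1)}"
  proof
    fix j assume that: "j \<in> {1..r}"
    have "F j \<inter> (fst \<circ> i) ` {1..r} = fst ` (F' j \<inter> i ` {1..r})" using F[OF that] by auto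
    then show "F j \<in> E \<and> F j \<inter> (fst \<circ> i) ` {1..r} = {(fst \<circ> i) j, (fst \<circ> i) (j + 1)}"
      using F'(2)[OF that] F[OF that] by simp
  qed
  moreover have "(fst \<circ> i) (r + 1) = (fst \<circ> i) 1" using close by simp
  ultimately have "\<not> balanced E"
    unfolding balanced_def not_not using r
    by (intro exI[of _ r] exI[of _ "fst \<circ> i"] exI[of _ F] conjI)
  then show False using assms by blast
qed


section \<open>Algebras spanned by monomials\<close>

text \<open>The span of the monomials \<open>x\<^sup>m t\<^sup>k\<close> with \<open>P k m\<close>.\<close>

definition monomial_algebra :: "(nat \<Rightarrow> (nat \<Rightarrow>\<^sub>0 nat) \<Rightarrow> bool) \<Rightarrow> 'k::field mpoly poly set" where
  "monomial_algebra P = {f. \<forall>k. \<forall>m\<in>Poly_Mapping.keys (coeff f k). P k m}"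

lemma S_subalgebraD:
  assumes "S_subalgebra n R"
  shows "R \<subseteq> t_poly_ring n"
    and "s \<in> poly_ring n \<Longrightarrow> [:s:] \<in> R"
    and "f \<in> R \<Longrightarrow> g \<in> R \<Longrightarrow> f + g \<in> R"
    and "f \<in> R \<Longrightarrow> g \<in> R \<Longrightarrow> f * g \<in> R"
  using assms by (simp_all add: S_subalgebra_def)

lemma sum_single_lookup: "(\<Sum>m\<in>Poly_Mapping.keys p. Poly_Mapping.single m (Poly_Mapping.lookup p m)) = p"
  by (rule poly_mapping_eqI)
    (auto simp: lookup_sum lookup_single when_def in_keys_iff sum.delta)

text \<open>The exponents of a product are sums of exponents of the factors, so a span of monomials is a
  subalgebra whenever its exponents form a monoid containing all those of \<open>S\<close>.\<close>

lemma S_subalgebra_monomial_algebra: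
  assumes vars: "\<And>k m. P k m \<Longrightarrow> Poly_Mapping.keys m \<subseteq> {1..n}"
    and zero: "\<And>m. Poly_Mapping.keys m \<subseteq> {1..n} \<Longrightarrow> P 0 m"
    and add: "\<And>k l m m'. P k m \<Longrightarrow> P l m' \<Longrightarrow> P (k + l) (m + m')"
  shows "S_subalgebra n (monomial_algebra P :: 'k::field mpoly poly set)"
  unfolding S_subalgebra_def
proof (intro conjI ballI)
  show "(monomial_algebra P :: 'k mpoly poly set) \<subseteq> t_poly_ring n"
    using vars by (auto simp: monomial_algebra_def t_poly_ring_def poly_ring_def)
next
  fix s :: "'k mpoly" assume "s \<in> poly_ring n"
  then show "[:s:] \<in> monomial_algebra P"
    using zero by (auto simp: monomial_algebra_def poly_ring_def coeff_pCons split: nat.splits)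
next
  fix f g :: "'k mpoly poly" assume fg: "f \<in> monomial_algebra P" "g \<in> monomial_algebra P"
  then show "f + g \<in> monomial_algebra P"
    using Poly_Mapping.keys_add[of "coeff f _" "coeff g _"] unfolding monomial_algebra_def by force
  have "P k m" if m: "m \<in> Poly_Mapping.keys (coeff (f * g) k)" for k m
  proof -
    have "m \<in> (\<Union>i\<in>{..k}. Poly_Mapping.keys (coeff f i * coeff g (k - i)))"
      using m Poly_Mapping.keys_sum[of "\<lambda>i. coeff f i * coeff g (k - i)" "{..k}"]
      by (auto simp only: coeff_mult)
    then obtain i where i: "i \<le> k" "m \<in> Poly_Mapping.keys (coeff f i * coeff g (k - i))" by auto
    then obtain a b where "m = a + b" "a \<in> Poly_Mapping.keys (coeff f i)"
      "b \<in> Poly_Mapping.keys (coeff g (k - i))"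
      using Poly_Mapping.keys_mult[of "coeff f i" "coeff g (k - i)"] by auto
    then show ?thesis
      using fg add[of i a "k - i" b] i(1) by (auto simp: monomial_algebra_def)
  qed
  then show "f * g \<in> monomial_algebra P" by (auto simp: monomial_algebra_def)
qed

lemma S_subalgebra_sum:
  assumes "S_subalgebra n R" and "\<And>i. i \<in> I \<Longrightarrow> f i \<in> R"
  shows "(\<Sum>i\<in>I. f i) \<in> R"
  using assms(2)
proof (induction I rule: infinite_finite_induct)
  have "[:0:] \<in> R" by (rule S_subalgebraD(2)[OF assms(1)]) (simp add: poly_ring_def)
  then have "0 \<in> R" by simp
  then show "(\<Sum>i\<in>I. f i) \<in> R" if "infinite I" for I using that by simp
  show "(\<Sum>i\<in>{}. f i) \<in> R" using \<open>0 \<in> R\<close> by simp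
qed (auto intro: S_subalgebraD(3)[OF assms(1)])

lemma monom_in_S_subalgebra:
  assumes "S_subalgebra n R" and "Poly_Mapping.keys e \<subseteq> {1..n}" and "monom (xpow m) k \<in> R"
  shows "monom (Poly_Mapping.single (m + e) a) k \<in> R"
proof -
  have "Poly_Mapping.single e a \<in> poly_ring n" using assms(2) by (simp add: poly_ring_def)
  then have "[:Poly_Mapping.single e a:] * monom (xpow m) k \<in> R"
    using assms(3) by (intro S_subalgebraD(2,4)[OF assms(1)])
  moreover have "[:Poly_Mapping.single e a:] * monom (xpow m) k = monom (Poly_Mapping.single (m + e) a) k"
    by (simp add: smult_monom xpow_def mult_single add.commute)
  ultimately show ?thesis by simp
qed

lemma monomial_algebra_subset:
  assumes R: "S_subalgebra n R" and gen: "\<And>k m. P k m \<Longrightarrow> monom (xpow m) k \<in> R"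
  shows "monomial_algebra P \<subseteq> R"
proof
  fix f :: "'a mpoly poly" assume f: "f \<in> monomial_algebra P"
  have "monom (coeff f k) k \<in> R" for k
  proof -
    have "monom (coeff f k) k =
        (\<Sum>m\<in>Poly_Mapping.keys (coeff f k). monom (Poly_Mapping.single m (Poly_Mapping.lookup (coeff f k) m)) k)"
      by (simp flip: monom_sum add: sum_single_lookup)
    also have "\<dots> \<in> R"
    proof (rule S_subalgebra_sum[OF R])
      fix m assume "m \<in> Poly_Mapping.keys (coeff f k)"
      then have "P k m" using f by (auto simp: monomial_algebra_def)
      then show "monom (Poly_Mapping.single m (Poly_Mapping.lookup (coeff f k) m)) k \<in> R"
        using monom_in_S_subalgebra[OF R, of 0 m k] gen by simp
    qed
    finally show ?thesis .
  qed
  then have "(\<Sum>k\<le>degree f. monom (coeff f k) k) \<in> R" by (intro S_subalgebra_sum[OF R])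
  then show "f \<in> R" by (simp add: poly_as_sum_of_monoms)
qed

lemma monom_xpow_in_monomial_algebra:
  "monom (xpow m) k \<in> (monomial_algebra P :: 'k::field mpoly poly set) \<longleftrightarrow> P k m"
  by (auto simp: monomial_algebra_def xpow_def)

lemma S_subalgebra_t_poly_ring: "S_subalgebra n (t_poly_ring n :: 'k::field mpoly poly set)"
proof -
  have "t_poly_ring n = (monomial_algebra (\<lambda>_ m. Poly_Mapping.keys m \<subseteq> {1..n}) :: 'k mpoly poly set)"
    by (auto simp: t_poly_ring_def monomial_algebra_def poly_ring_def)
  moreover have "S_subalgebra n (monomial_algebra (\<lambda>_ m. Poly_Mapping.keys m \<subseteq> {1..n}) :: 'k mpoly poly set)"
    by (rule S_subalgebra_monomial_algebra) (auto dest!: subsetD[OF Poly_Mapping.keys_add])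
  ultimately show ?thesis by simp
qed

text \<open>The bound on \<open>G\<close> guarantees that some subalgebra contains \<open>G\<close>, so that the hull is an
  intersection of a nonempty family and stays inside \<open>S[t]\<close>.\<close>

lemma S_subalgebra_hull:
  assumes "G \<subseteq> t_poly_ring n"
  shows "S_subalgebra n (S_subalgebra n hull G)"
  unfolding S_subalgebra_def[of n "_ hull _"]
proof (intro conjI ballI)
  show "S_subalgebra n hull G \<subseteq> t_poly_ring n"
    by (rule hull_minimal) (use assms S_subalgebra_t_poly_ring in auto)
qed (auto simp: hull_def S_subalgebra_def)

section \<open>Covers\<close>

text \<open>Compared with \<^const>\<open>is_cover\<close>, the zero vector is admitted.  This makes no difference for
  \<open>k \<ge> 1\<close>, and for \<open>k = 0\<close> it yields all monomials of \<open>S = J\<^sub>0(\<Gamma>)\<close>, so that one condition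
  describes \<open>A(\<Gamma>)\<close> in all degrees.\<close>

definition weak_cover :: "nat \<Rightarrow> nat set set \<Rightarrow> nat \<Rightarrow> (nat \<Rightarrow>\<^sub>0 nat) \<Rightarrow> bool" where
  "weak_cover n \<Gamma> k c \<longleftrightarrow>
     Poly_Mapping.keys c \<subseteq> {1..n} \<and> (\<forall>F\<in>facets \<Gamma>. k \<le> (\<Sum>i\<in>F. Poly_Mapping.lookup c i))"

lemma facets_nonempty:
  assumes "simplicial_complex n \<Gamma>"
  shows "facets \<Gamma> \<noteq> {}"
proof -
  have "finite \<Gamma>" using assms by (auto simp: simplicial_complex_def intro: finite_subset)
  then obtain F where "F \<in> \<Gamma>" "\<forall>G\<in>\<Gamma>. F \<subseteq> G \<longrightarrow> F = G"
    using finite_has_maximal[of \<Gamma>] assms by (auto simp: simplicial_complex_def)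
  then show ?thesis by (auto simp: facets_def)
qed

lemma facet_subset:
  assumes "simplicial_complex n \<Gamma>" and "F \<in> facets \<Gamma>"
  shows "F \<subseteq> {1..n}"
  using assms by (auto simp: simplicial_complex_def facets_def)

lemma is_cover_iff_weak_cover:
  assumes "simplicial_complex n \<Gamma>" and "k \<ge> 1"
  shows "is_cover n \<Gamma> k c \<longleftrightarrow> weak_cover n \<Gamma> k c"
proof -
  have "\<not> weak_cover n \<Gamma> k 0"
    using facets_nonempty[OF assms(1)] assms(2) by (auto simp: weak_cover_def)
  then show ?thesis by (auto simp: is_cover_def weak_cover_def)
qed

lemma weak_cover_add:
  assumes "weak_cover n \<Gamma> k c" and "weak_cover n \<Gamma> l d"
  shows "weak_cover n \<Gamma> (k + l) (c + d)"
proof -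
  have "Poly_Mapping.keys (c + d) \<subseteq> {1..n}"
    using assms Poly_Mapping.keys_add[of c d] by (auto simp: weak_cover_def)
  then show ?thesis
    using assms by (auto simp: weak_cover_def lookup_add sum.distrib intro: add_mono)
qed

lemma span_xpow:
  "mpoly.span {xpow c | c. Q c} = {p :: 'k::field mpoly. \<forall>m\<in>Poly_Mapping.keys p. Q m}"
proof
  have "{xpow c | c. Q c} \<subseteq> {p :: 'k mpoly. \<forall>m\<in>Poly_Mapping.keys p. Q m}"
    by (auto simp: xpow_def)
  moreover have "mpoly.subspace {p :: 'k mpoly. \<forall>m\<in>Poly_Mapping.keys p. Q m}"
  proof (rule mpoly.subspaceI)
    fix p q :: "'k mpoly" and a :: 'k
    assume p: "p \<in> {p. \<forall>m\<in>Poly_Mapping.keys p. Q m}"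
    show "mpoly_scale a p \<in> {p. \<forall>m\<in>Poly_Mapping.keys p. Q m}"
      using p Poly_Mapping.keys_mult[of "Poly_Mapping.single 0 a" p]
      by (fastforce simp: mpoly_scale_def split: if_splits)
    assume "q \<in> {p. \<forall>m\<in>Poly_Mapping.keys p. Q m}"
    then show "p + q \<in> {p. \<forall>m\<in>Poly_Mapping.keys p. Q m}"
      using p Poly_Mapping.keys_add[of p q] by auto
  qed simp
  ultimately show "mpoly.span {xpow c | c. Q c} \<subseteq> {p :: 'k mpoly. \<forall>m\<in>Poly_Mapping.keys p. Q m}"
    by (rule mpoly.span_minimal)
  show "{p :: 'k mpoly. \<forall>m\<in>Poly_Mapping.keys p. Q m} \<subseteq> mpoly.span {xpow c | c. Q c}"
  proof
    fix p :: "'k mpoly" assume p: "p \<in> {p. \<forall>m\<in>Poly_Mapping.keys p. Q m}"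
    have "p = (\<Sum>m\<in>Poly_Mapping.keys p. mpoly_scale (Poly_Mapping.lookup p m) (xpow m))"
      by (simp add: mpoly_scale_def xpow_def mult_single sum_single_lookup)
    also have "\<dots> \<in> mpoly.span {xpow c | c. Q c}"
      using p by (intro mpoly.span_sum mpoly.span_scale mpoly.span_base) auto
    finally show "p \<in> mpoly.span {xpow c | c. Q c}" .
  qed
qed

lemma vertex_cover_algebra_eq:
  assumes "simplicial_complex n \<Gamma>"
  shows "vertex_cover_algebra n \<Gamma> = (monomial_algebra (weak_cover n \<Gamma>) :: 'k::field mpoly poly set)"
proof -
  have "cover_ideal n \<Gamma> k = {p :: 'k mpoly. \<forall>m\<in>Poly_Mapping.keys p. weak_cover n \<Gamma> k m}" for k
  proof (cases "k = 0")
    case True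
    then show ?thesis by (simp add: cover_ideal_def poly_ring_def weak_cover_def)
  next
    case False
    then have "is_cover n \<Gamma> k = weak_cover n \<Gamma> k"
      using is_cover_iff_weak_cover[OF assms] by fastforce
    then show ?thesis using False by (simp add: cover_ideal_def span_xpow)
  qed
  then show ?thesis by (simp add: vertex_cover_algebra_def monomial_algebra_def)
qed

lemma S_subalgebra_vertex_cover_algebra:
  assumes "simplicial_complex n \<Gamma>"
  shows "S_subalgebra n (vertex_cover_algebra n \<Gamma> :: 'k::field mpoly poly set)"
  unfolding vertex_cover_algebra_eq[OF assms]
  by (rule S_subalgebra_monomial_algebra) (simp_all add: weak_cover_add, simp_all add: weak_cover_def)

text \<open>These are the exponents of the algebra generated in degree one: \<open>e\<close> stands for the monomial
  coefficient from \<open>S\<close> in front of a product of generators \<open>x\<^sup>d t\<close>.\<close>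

definition decomposable :: "nat \<Rightarrow> nat set set \<Rightarrow> nat \<Rightarrow> (nat \<Rightarrow>\<^sub>0 nat) \<Rightarrow> bool" where
  "decomposable n \<Gamma> k c \<longleftrightarrow>
     (\<exists>ds e. length ds = k \<and> (\<forall>d\<in>set ds. weak_cover n \<Gamma> 1 d) \<and>
        Poly_Mapping.keys e \<subseteq> {1..n} \<and> c = sum_list ds + e)"

lemma decomposable_add:
  assumes "decomposable n \<Gamma> k c" and "decomposable n \<Gamma> l d"
  shows "decomposable n \<Gamma> (k + l) (c + d)"
proof -
  obtain cs e where c: "length cs = k" "\<forall>d\<in>set cs. weak_cover n \<Gamma> 1 d"
      "Poly_Mapping.keys e \<subseteq> {1..n}" "c = sum_list cs + e"
    using assms(1) by (auto simp: decomposable_def)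
  obtain ds e' where d: "length ds = l" "\<forall>d\<in>set ds. weak_cover n \<Gamma> 1 d"
      "Poly_Mapping.keys e' \<subseteq> {1..n}" "d = sum_list ds + e'"
    using assms(2) by (auto simp: decomposable_def)
  show ?thesis
    unfolding decomposable_def
  proof (intro exI conjI)
    show "c + d = sum_list (cs @ ds) + (e + e')" using c(4) d(4) by (simp add: ac_simps)
    show "Poly_Mapping.keys (e + e') \<subseteq> {1..n}"
      using c(3) d(3) Poly_Mapping.keys_add[of e e'] by blast
  qed (use c d in auto)
qed

lemma decomposable_vars:
  assumes "decomposable n \<Gamma> k c"
  shows "Poly_Mapping.keys c \<subseteq> {1..n}"
proof -
  have "Poly_Mapping.keys (sum_list ds) \<subseteq> {1..n}" if "\<forall>d\<in>set ds. weak_cover n \<Gamma> 1 d" for ds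
    using that
  proof (induction ds)
    case (Cons d ds)
    then show ?case using Poly_Mapping.keys_add[of d "sum_list ds"] by (auto simp: weak_cover_def)
  qed simp
  then show ?thesis
    using assms Poly_Mapping.keys_add by (fastforce simp: decomposable_def)
qed

lemma monom_sum_list_in_S_subalgebra:
  assumes R: "S_subalgebra n R" and ds: "\<And>d. d \<in> set ds \<Longrightarrow> monom (xpow d) 1 \<in> R"
    and e: "Poly_Mapping.keys e \<subseteq> {1..n}"
  shows "monom (xpow (sum_list ds + e)) (length ds) \<in> R"
proof -
  have "monom (xpow (sum_list ds)) (length ds) \<in> R"
    using ds
  proof (induction ds)
    case Nil
    have "(1 :: 'a mpoly) \<in> poly_ring n" by (simp add: poly_ring_def)
    then have "[:1:] \<in> R" using R by (auto simp: S_subalgebra_def)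
    then show ?case by (simp add: xpow_def monom_0 flip: single_one)
  next
    case (Cons d ds)
    then have "monom (xpow d) 1 * monom (xpow (sum_list ds)) (length ds) \<in> R"
      using R by (auto simp: S_subalgebra_def)
    then show ?case by (simp add: mult_monom xpow_def mult_single)
  qed
  from monom_in_S_subalgebra[OF R e this, of 1] show ?thesis by (simp add: xpow_def)
qed

text \<open>The decomposable exponents form a monoid, hence span a subalgebra, and this subalgebra
  contains the generators of degree one.\<close>

lemma hull_degree_one_vertex_cover_algebra:
  assumes "simplicial_complex n \<Gamma>"
  shows "S_subalgebra n hull {f \<in> vertex_cover_algebra n \<Gamma>. \<exists>s. f = monom s 1} \<subseteq>
    (monomial_algebra (decomposable n \<Gamma>) :: 'k::field mpoly poly set)"
proof (rule hull_minimal)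
  have "weak_cover n \<Gamma> (Suc 0) m \<Longrightarrow> decomposable n \<Gamma> (Suc 0) m" for m
    unfolding decomposable_def by (rule exI[of _ "[m]"], rule exI[of _ 0]) simp
  then show "{f \<in> vertex_cover_algebra n \<Gamma>. \<exists>s. f = monom s 1} \<subseteq>
      (monomial_algebra (decomposable n \<Gamma>) :: 'k mpoly poly set)"
    unfolding vertex_cover_algebra_eq[OF assms]
    by (auto simp: monomial_algebra_def split: if_splits)
  show "S_subalgebra n (monomial_algebra (decomposable n \<Gamma>) :: 'k mpoly poly set)"
  proof (rule S_subalgebra_monomial_algebra)
    show "decomposable n \<Gamma> 0 m" if "Poly_Mapping.keys m \<subseteq> {1..n}" for m
      using that by (simp add: decomposable_def)
  qed (rule decomposable_vars decomposable_add; assumption)+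
qed

lemma squarefree_generators_subset:
  assumes "simplicial_complex n \<Gamma>"
  shows "{monom (xpow c) k | c k. k \<ge> 1 \<and> squarefree_cover n \<Gamma> k c} \<subseteq>
    (vertex_cover_algebra n \<Gamma> :: 'k::field mpoly poly set)"
  unfolding vertex_cover_algebra_eq[OF assms]
  using is_cover_iff_weak_cover[OF assms]
  by (auto simp: monom_xpow_in_monomial_algebra squarefree_cover_def)

lemma squarefree_cover_algebra_subset:
  assumes "simplicial_complex n \<Gamma>"
  shows "squarefree_cover_algebra n \<Gamma> \<subseteq> (vertex_cover_algebra n \<Gamma> :: 'k::field mpoly poly set)"
  unfolding squarefree_cover_algebra_def
  by (rule hull_minimal)
    (use squarefree_generators_subset[OF assms] S_subalgebra_vertex_cover_algebra[OF assms] in auto)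

lemma S_subalgebra_squarefree_cover_algebra:
  assumes "simplicial_complex n \<Gamma>"
  shows "S_subalgebra n (squarefree_cover_algebra n \<Gamma> :: 'k::field mpoly poly set)"
  unfolding squarefree_cover_algebra_def
  using squarefree_generators_subset[OF assms] S_subalgebra_vertex_cover_algebra[OF assms]
  by (intro S_subalgebra_hull) (auto simp: S_subalgebra_def)

lemma standard_graded_vertex_cover_algebra:
  assumes \<Gamma>: "simplicial_complex n \<Gamma>"
    and dec: "\<And>k c. weak_cover n \<Gamma> k c \<Longrightarrow> decomposable n \<Gamma> k c"
  shows "standard_graded n (vertex_cover_algebra n \<Gamma> :: 'k::field mpoly poly set)"
  unfolding standard_graded_def
proof
  let ?A = "vertex_cover_algebra n \<Gamma> :: 'k mpoly poly set"
  let ?G = "{f \<in> ?A. \<exists>s. f = monom s 1}"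
  have A: "S_subalgebra n ?A" by (rule S_subalgebra_vertex_cover_algebra[OF \<Gamma>])
  then have hull: "S_subalgebra n (S_subalgebra n hull ?G)"
    by (intro S_subalgebra_hull) (auto simp: S_subalgebra_def)
  have one: "monom (xpow d) 1 \<in> S_subalgebra n hull ?G" if "weak_cover n \<Gamma> 1 d" for d
    by (rule hull_inc) (use that in \<open>auto simp: vertex_cover_algebra_eq[OF \<Gamma>] monom_xpow_in_monomial_algebra\<close>)
  have "monomial_algebra (weak_cover n \<Gamma>) \<subseteq> S_subalgebra n hull ?G"
  proof (rule monomial_algebra_subset[OF hull])
    fix k m assume "weak_cover n \<Gamma> k m"
    then obtain ds e where "length ds = k" "\<forall>d\<in>set ds. weak_cover n \<Gamma> 1 d"
        "Poly_Mapping.keys e \<subseteq> {1..n}" "m = sum_list ds + e"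
      using dec by (metis decomposable_def)
    then show "monom (xpow m) k \<in> S_subalgebra n hull ?G"
      using monom_sum_list_in_S_subalgebra[OF hull, of ds e] one by blast
  qed
  then show "?A \<subseteq> S_subalgebra n hull ?G" by (simp add: vertex_cover_algebra_eq[OF \<Gamma>])
  show "S_subalgebra n hull ?G \<subseteq> ?A" by (rule hull_minimal) (use A in auto)
qed

lemma lookup_le_sum_list:
  assumes "d \<in> set ds"
  shows "Poly_Mapping.lookup d i \<le> Poly_Mapping.lookup (sum_list ds :: nat \<Rightarrow>\<^sub>0 nat) i"
  using assms by (induction ds) (auto simp: lookup_add)

text \<open>The summands in a decomposition of a squarefree cover lie below it.  They are therefore
  squarefree themselves, and their monomials belong to \<open>B(\<Gamma>)\<close>.\<close>

lemma standard_graded_squarefree_cover_algebra: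
  assumes \<Gamma>: "simplicial_complex n \<Gamma>"
    and dec: "\<And>k c. weak_cover n \<Gamma> k c \<Longrightarrow> decomposable n \<Gamma> k c"
  shows "standard_graded n (squarefree_cover_algebra n \<Gamma> :: 'k::field mpoly poly set)"
  unfolding standard_graded_def
proof
  let ?B = "squarefree_cover_algebra n \<Gamma> :: 'k mpoly poly set"
  let ?G = "{f \<in> ?B. \<exists>s. f = monom s 1}"
  have B: "S_subalgebra n ?B" by (rule S_subalgebra_squarefree_cover_algebra[OF \<Gamma>])
  then have hull: "S_subalgebra n (S_subalgebra n hull ?G)"
    by (intro S_subalgebra_hull) (auto simp: S_subalgebra_def)
  have one: "monom (xpow d) 1 \<in> S_subalgebra n hull ?G" if "squarefree_cover n \<Gamma> 1 d" for d
  proof -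
    have "monom (xpow d) 1 \<in> ?B"
      unfolding squarefree_cover_algebra_def by (rule hull_inc) (use that in auto)
    then show ?thesis by (intro hull_inc) auto
  qed
  show "?B \<subseteq> S_subalgebra n hull ?G"
  proof (subst squarefree_cover_algebra_def, rule hull_minimal[of _ _ "S_subalgebra n", OF _ hull], clarify)
    fix c k assume k: "1 \<le> k" and c: "squarefree_cover n \<Gamma> k c"
    then have "decomposable n \<Gamma> k c"
      using dec is_cover_iff_weak_cover[OF \<Gamma> k] by (auto simp: squarefree_cover_def)
    then obtain ds e where ds: "length ds = k" "\<forall>d\<in>set ds. weak_cover n \<Gamma> 1 d"
        "Poly_Mapping.keys e \<subseteq> {1..n}" "c = sum_list ds + e"
      by (auto simp: decomposable_def)
    have "squarefree_cover n \<Gamma> 1 d" if d: "d \<in> set ds" for d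
    proof -
      have "Poly_Mapping.lookup d i \<le> 1" for i
      proof -
        have "Poly_Mapping.lookup d i \<le> Poly_Mapping.lookup c i"
          using lookup_le_sum_list[OF d, of i] ds(4) by (simp add: lookup_add)
        also have "\<dots> \<le> 1" using c by (simp add: squarefree_cover_def)
        finally show ?thesis .
      qed
      then show ?thesis
        using ds(2) d is_cover_iff_weak_cover[OF \<Gamma>, of 1] by (simp add: squarefree_cover_def)
    qed
    then show "monom (xpow c) k \<in> S_subalgebra n hull ?G"
      using monom_sum_list_in_S_subalgebra[OF hull, of ds e] one ds by blast
  qed
  show "S_subalgebra n hull ?G \<subseteq> ?B" by (rule hull_minimal) (use B in auto)
qed


section \<open>Covers and odd special cycles\<close>

text \<open>The point is the distinctness of the facets of the cycle.  Equal facets at positions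
  \<open>a\<close> and \<open>b\<close> would join the same two vertices, which for \<open>r \<ge> 3\<close> are never joined twice.\<close>

lemma balanced_facets:
  assumes \<Delta>: "simplicial_complex n \<Delta>" and no: "\<nexists>r i F. odd r \<and> special_cycle n \<Delta> r i F"
    and sub: "E \<subseteq> facets \<Delta>"
  shows "balanced E"
proof (rule ccontr)
  assume "\<not> balanced E"
  then obtain r :: nat and i F where
    r: "odd r" "r \<ge> 3" and inj: "inj_on i {1..r}" and close: "i (r + 1) = i 1"
    and cycle: "\<forall>j\<in>{1..r}. F j \<in> E \<and> F j \<inter> i ` {1..r} = {i j, i (j + 1)}"
    unfolding balanced_def not_not by (elim exE conjE) (rule that; assumption)
  have FE: "F j \<in> E" and Fi: "F j \<inter> i ` {1..r} = {i j, i (j + 1)}" if "j \<in> {1..r}" for j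
    using bspec[OF cycle that] by (rule conjunct1, rule conjunct2)
  have mem: "i j \<in> F j" "i (j + 1) \<in> F j" if "j \<in> {1..r}" for j
    using Fi[OF that] by blast+
  have eqD: "a = b" if "i a = i b" "a \<in> {1..r}" "b \<in> {1..r}" for a b
    using inj_onD[OF inj that] .
  have "F a \<noteq> F b" if ab: "a < b" "a \<in> {1..r}" "b \<in> {1..r}" for a b
  proof
    assume "F a = F b"
    then have "{i a, i (a + 1)} = {i b, i (b + 1)}" using Fi ab by metis
    moreover have "i a \<noteq> i b" using eqD[of a b] ab by auto
    ultimately have "i a = i (b + 1)" "i (a + 1) = i b" by (auto simp: doubleton_eq_iff)
    then show False
      using eqD[of a "b + 1"] eqD[of a 1] eqD[of "a + 1" b] close r ab by (cases "b = r") auto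
  qed
  then have "inj_on F {1..r}" by (intro linorder_inj_onI) auto
  moreover have "i ` {1..r} \<subseteq> {1..n}"
    using mem(1) FE sub facet_subset[OF \<Delta>] by blast
  moreover have "card (F j \<inter> i ` {1..r}) = 2" if j: "j \<in> {1..r}" for j
  proof -
    have "i j \<noteq> i (j + 1)"
      using eqD[of j "j + 1"] eqD[of j 1] close r j by (cases "j = r") auto
    then show ?thesis using Fi[OF j] by simp
  qed
  moreover have "F ` {1..r} \<subseteq> facets \<Delta>" using FE sub by blast
  ultimately have "special_cycle n \<Delta> r i F"
    unfolding special_cycle_def is_cycle_def
    using r inj close mem by (intro conjI ballI) simp_all
  then show False using no r by blast
qed

text \<open>The elements of \<open>V\<close> are \<open>c\<^sub>i\<close> copies of each vertex \<open>i\<close>.  The cover condition says that the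
  preimage of a facet has at least \<open>k\<close> elements in \<open>V\<close>, and so Berge's theorem puts all \<open>k\<close> colours
  into it.  Counting the copies of each vertex in the colour class \<open>l\<close> gives the cover \<open>d l\<close>.\<close>

lemma weak_cover_decomposable:
  assumes \<Gamma>: "simplicial_complex n \<Gamma>" and bal: "balanced (facets \<Gamma>)" and c: "weak_cover n \<Gamma> k c"
  shows "decomposable n \<Gamma> k c"
proof -
  define V where "V = (SIGMA i:Poly_Mapping.keys c. {..<Poly_Mapping.lookup c i})"
  have "finite V" by (simp add: V_def)
  have "finite \<Gamma>" using \<Gamma> by (auto simp: simplicial_complex_def intro: finite_subset)
  then have "finite (facets \<Gamma>)" by (simp add: facets_def)
  have size: "card (fst -` F \<inter> V) = (\<Sum>i\<in>F. Poly_Mapping.lookup c i)" if "F \<in> facets \<Gamma>" for F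
  proof -
    have fin: "finite F" using facet_subset[OF \<Gamma> that] finite_subset by blast
    have "fst -` F \<inter> V = (SIGMA i:F \<inter> Poly_Mapping.keys c. {..<Poly_Mapping.lookup c i})"
      by (auto simp: V_def)
    then have "card (fst -` F \<inter> V) = (\<Sum>i\<in>F \<inter> Poly_Mapping.keys c. Poly_Mapping.lookup c i)"
      using fin by simp
    also have "\<dots> = (\<Sum>i\<in>F. Poly_Mapping.lookup c i)"
      using fin by (intro sum.mono_neutral_left) (auto simp: in_keys_iff)
    finally show ?thesis .
  qed
  obtain f where f: "\<forall>F\<in>(\<lambda>F. fst -` F) ` facets \<Gamma>. k \<le> card (F \<inter> V) \<longrightarrow> {..<k} \<subseteq> f ` (F \<inter> V)"
    using balanced_good_colouring[OF balanced_replication[OF bal] _ \<open>finite V\<close>, of k]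
      \<open>finite (facets \<Gamma>)\<close> by blast
  define d where "d l = (\<Sum>v\<in>{v\<in>V. f v = l}. Poly_Mapping.single (fst v) (1::nat))" for l
  \<comment> \<open>The colouring may use colours from \<open>k\<close> onwards; their vertices go into the remainder.\<close>
  define e where "e = (\<Sum>v\<in>{v\<in>V. f v \<ge> k}. Poly_Mapping.single (fst v) (1::nat))"
  have total: "c = sum_list (map d [0..<k]) + e"
  proof -
    have "c = (\<Sum>i\<in>Poly_Mapping.keys c. \<Sum>s<Poly_Mapping.lookup c i. Poly_Mapping.single i (1::nat))"
    proof -
      have "(\<Sum>s<m. Poly_Mapping.single i (1::nat)) = Poly_Mapping.single i m" for i :: nat and m :: nat
        by (induction m) (simp_all add: single_add[symmetric] del: sum_constant)
      then show ?thesis by (simp add: sum_single_lookup del: sum_constant)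
    qed
    also have "\<dots> = (\<Sum>v\<in>V. Poly_Mapping.single (fst v) 1)"
      by (subst sum.Sigma) (auto simp: V_def case_prod_unfold)
    also have "V = {v\<in>V. f v < k} \<union> {v\<in>V. f v \<ge> k}" by auto
    also have "(\<Sum>v\<in>\<dots>. Poly_Mapping.single (fst v) 1) =
        (\<Sum>v\<in>{v\<in>V. f v < k}. Poly_Mapping.single (fst v) 1) + e"
      unfolding e_def by (rule sum.union_disjoint) (use \<open>finite V\<close> in auto)
    also have "(\<Sum>v\<in>{v\<in>V. f v < k}. Poly_Mapping.single (fst v) 1) = (\<Sum>l<k. d l)"
    proof -
      have "(\<Sum>l<k. sum (\<lambda>v. Poly_Mapping.single (fst v) 1) {v \<in> {v\<in>V. f v < k}. f v = l}) =
          (\<Sum>v\<in>{v\<in>V. f v < k}. Poly_Mapping.single (fst v) (1::nat))"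
        by (rule sum.group) (use \<open>finite V\<close> in auto)
      moreover have "{v \<in> {v\<in>V. f v < k}. f v = l} = {v\<in>V. f v = l}" if "l < k" for l
        using that by auto
      ultimately show ?thesis by (simp add: d_def)
    qed
    also have "\<dots> = sum_list (map d [0..<k])"
      by (simp add: interv_sum_list_conv_sum_set_nat lessThan_atLeast0)
    finally show ?thesis .
  qed
  have vars: "Poly_Mapping.keys (\<Sum>v\<in>A. Poly_Mapping.single (fst v) (1::nat)) \<subseteq> {1..n}"
    if "A \<subseteq> V" for A
  proof -
    have "Poly_Mapping.keys (\<Sum>v\<in>A. Poly_Mapping.single (fst v) (1::nat)) \<subseteq> fst ` A"
      using Poly_Mapping.keys_sum[of "\<lambda>v. Poly_Mapping.single (fst v) (1::nat)" A] by auto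
    also have "\<dots> \<subseteq> Poly_Mapping.keys c" using that by (auto simp: V_def)
    also have "\<dots> \<subseteq> {1..n}" using c by (simp add: weak_cover_def)
    finally show ?thesis .
  qed
  have "weak_cover n \<Gamma> 1 (d l)" if l: "l < k" for l
    unfolding weak_cover_def
  proof (intro conjI ballI)
    show "Poly_Mapping.keys (d l) \<subseteq> {1..n}" unfolding d_def by (rule vars) auto
    fix F assume F: "F \<in> facets \<Gamma>"
    have "k \<le> card (fst -` F \<inter> V)" using c F by (simp add: size weak_cover_def)
    then obtain v where v: "v \<in> V" "fst v \<in> F" "f v = l"
      using f F l by (auto dest!: subsetD)
    have "1 = Poly_Mapping.lookup (Poly_Mapping.single (fst v) (1::nat)) (fst v)" by simp
    also have "\<dots> \<le> Poly_Mapping.lookup (d l) (fst v)"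
      unfolding d_def lookup_sum by (rule member_le_sum) (use v \<open>finite V\<close> in auto)
    also have "\<dots> \<le> (\<Sum>i\<in>F. Poly_Mapping.lookup (d l) i)"
      by (rule member_le_sum) (use v facet_subset[OF \<Gamma> F] finite_subset in auto)
    finally show "1 \<le> (\<Sum>i\<in>F. Poly_Mapping.lookup (d l) i)" .
  qed
  moreover have "Poly_Mapping.keys e \<subseteq> {1..n}" unfolding e_def by (rule vars) auto
  ultimately show ?thesis
    unfolding decomposable_def using total by (intro exI[of _ "map d [0..<k]"] exI[of _ e]) auto
qed

text \<open>With \<open>\<Gamma>\<close> spanned by the facets of the cycle and \<open>c\<close> the indicator vector of its \<open>r\<close> vertices, a
  decomposition would need two covers of order one with total weight at most \<open>r\<close>, while each of
  them weighs more than \<open>r / 2\<close>.\<close>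

lemma odd_special_cycle_indecomposable:
  assumes \<Delta>: "simplicial_complex n \<Delta>" and "odd r" and cyc: "special_cycle n \<Delta> r i F"
  shows "\<exists>\<Gamma> c. subcomplex n \<Gamma> \<Delta> \<and> squarefree_cover n \<Gamma> 2 c \<and> \<not> decomposable n \<Gamma> 2 c"
proof -
  have r: "r \<ge> 2" and range: "i ` {1..r} \<subseteq> {1..n}" and inj: "inj_on i {1..r}"
    and close: "i (r + 1) = i 1" and facet: "\<And>j. j \<in> {1..r} \<Longrightarrow> F j \<in> facets \<Delta>"
    and mem: "\<And>j. j \<in> {1..r} \<Longrightarrow> i j \<in> F j \<and> i (j + 1) \<in> F j"
    and two: "\<And>j. j \<in> {1..r} \<Longrightarrow> card (F j \<inter> i ` {1..r}) = 2"
    using cyc by (auto simp: special_cycle_def is_cycle_def)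
  define I where "I = i ` {1..r}"
  have "finite I" "card I = r" using inj by (simp_all add: I_def card_image)
  have FI: "F j \<inter> I = {i j, i (j + 1)}" "i j \<noteq> i (j + 1)" if j: "j \<in> {1..r}" for j
  proof -
    have "i (j + 1) \<in> I"
      using j close r by (cases "j = r") (auto simp: I_def)
    moreover show ne: "i j \<noteq> i (j + 1)"
      using inj_onD[OF inj, of j "j + 1"] inj_onD[OF inj, of j 1] close r j by (cases "j = r") auto
    ultimately have "{i j, i (j + 1)} \<subseteq> F j \<inter> I" using mem[OF j] j by (auto simp: I_def)
    then show "F j \<inter> I = {i j, i (j + 1)}"
      using card_subset_eq[of "F j \<inter> I" "{i j, i (j + 1)}"] two[OF j] ne \<open>finite I\<close>
      by (simp add: I_def)
  qed
  have finF: "finite (F j)" if "j \<in> {1..r}" for j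
    using facet_subset[OF \<Delta> facet[OF that]] finite_subset by blast
  define \<Gamma> where "\<Gamma> = {G. \<exists>j\<in>{1..r}. G \<subseteq> F j}"
  have \<Gamma>: "simplicial_complex n \<Gamma>"
    unfolding simplicial_complex_def
  proof (intro conjI)
    show "\<Gamma> \<noteq> {}" using r by (auto simp: \<Gamma>_def intro!: exI[of _ "{}"] exI[of _ 1])
    show "\<Gamma> \<subseteq> Pow {1..n}" using facet_subset[OF \<Delta> facet] by (fastforce simp: \<Gamma>_def)
    show "\<forall>G\<in>\<Gamma>. \<forall>H. H \<subseteq> G \<longrightarrow> H \<in> \<Gamma>" by (auto simp: \<Gamma>_def)
  qed
  have facets_\<Gamma>: "facets \<Gamma> = F ` {1..r}"
  proof
    show "facets \<Gamma> \<subseteq> F ` {1..r}" by (auto simp: facets_def \<Gamma>_def)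
    have "F j \<in> \<Delta>" if "j \<in> {1..r}" for j using facet[OF that] by (simp add: facets_def)
    then have "\<Gamma> \<subseteq> \<Delta>" using \<Delta> unfolding \<Gamma>_def simplicial_complex_def by blast
    then have "F j \<in> facets \<Gamma>" if "j \<in> {1..r}" for j
      using facet[OF that] that unfolding facets_def by (auto simp: \<Gamma>_def)
    then show "F ` {1..r} \<subseteq> facets \<Gamma>" by blast
  qed
  then have sub: "subcomplex n \<Gamma> \<Delta>" using \<Gamma> facet by (auto simp: subcomplex_def)
  define c where "c = (\<Sum>x\<in>I. Poly_Mapping.single x (1::nat))"
  have lookup_c: "Poly_Mapping.lookup c x = (if x \<in> I then 1 else 0)" for x
    using \<open>finite I\<close> by (simp add: c_def lookup_sum lookup_single when_def sum.delta)
  have keys_c: "Poly_Mapping.keys c = I" by (auto simp: in_keys_iff lookup_c split: if_splits)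
  have F_sum: "(\<Sum>x\<in>F j. Poly_Mapping.lookup d x) = Poly_Mapping.lookup d (i j) + Poly_Mapping.lookup d (i (j + 1))"
    if d: "Poly_Mapping.keys d \<subseteq> I" and j: "j \<in> {1..r}" for d :: "nat \<Rightarrow>\<^sub>0 nat" and j
  proof -
    have "(\<Sum>x\<in>F j. Poly_Mapping.lookup d x) = (\<Sum>x\<in>F j \<inter> I. Poly_Mapping.lookup d x)"
      by (rule sum.mono_neutral_right) (use finF[OF j] d in \<open>auto simp: in_keys_iff\<close>)
    then show ?thesis using FI[OF j] by simp
  qed
  have "squarefree_cover n \<Gamma> 2 c"
    unfolding squarefree_cover_def is_cover_def
  proof (intro conjI allI ballI)
    show "Poly_Mapping.keys c \<subseteq> {1..n}" using range by (simp add: keys_c I_def)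
    show "c \<noteq> 0" using keys_c \<open>card I = r\<close> r by auto
    show "Poly_Mapping.lookup c x \<le> 1" for x by (simp add: lookup_c)
    fix G assume "G \<in> facets \<Gamma>"
    then obtain j where j: "j \<in> {1..r}" "G = F j" by (auto simp: facets_\<Gamma>)
    have "i j \<in> I" "i (j + 1) \<in> I" using FI(1)[OF j(1)] by auto
    then show "2 \<le> (\<Sum>x\<in>G. Poly_Mapping.lookup c x)"
      using F_sum[of c j] j by (simp add: keys_c lookup_c)
  qed
  moreover have "\<not> decomposable n \<Gamma> 2 c"
  proof
    assume "decomposable n \<Gamma> 2 c"
    then obtain ds e where ds: "length ds = 2" "\<forall>d\<in>set ds. weak_cover n \<Gamma> 1 d" "c = sum_list ds + e"
      by (auto simp: decomposable_def)
    then obtain a b where ab: "ds = [a, b]"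
      by (metis (no_types, lifting) One_nat_def Suc_1 length_0_conv length_Suc_conv)
    have c_eq: "Poly_Mapping.lookup c x = Poly_Mapping.lookup a x + Poly_Mapping.lookup b x + Poly_Mapping.lookup e x" for x
      using ds(3) ab by (simp add: lookup_add)
    \<comment> \<open>Summing the cover condition over the cycle counts each vertex twice.  This gives \<open>\<le>\<close>, and
      parity excludes equality.\<close>
    have large: "r < 2 * (\<Sum>x\<in>I. Poly_Mapping.lookup d x)"
      if d: "weak_cover n \<Gamma> 1 d" "Poly_Mapping.keys d \<subseteq> I" for d
    proof -
      have shift: "(\<Sum>j=1..r. Poly_Mapping.lookup d (i (j + 1))) = (\<Sum>j=1..r. Poly_Mapping.lookup d (i j))"
      proof -
        have "(\<Sum>j=1..r. Poly_Mapping.lookup d (i (j + 1))) = (\<Sum>j=2..r+1. Poly_Mapping.lookup d (i j))"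
          using sum.shift_bounds_cl_nat_ivl[of "\<lambda>j. Poly_Mapping.lookup d (i j)" 1 1 r] by (simp add: numeral_2_eq_2)
        also have "\<dots> = (\<Sum>j=2..r. Poly_Mapping.lookup d (i j)) + Poly_Mapping.lookup d (i 1)"
          using r close by simp
        also have "\<dots> = (\<Sum>j=1..r. Poly_Mapping.lookup d (i j))"
          using r sum.atLeast_Suc_atMost[of 1 r "\<lambda>j. Poly_Mapping.lookup d (i j)"]
          by (simp add: numeral_2_eq_2)
        finally show ?thesis .
      qed
      have "r = (\<Sum>j=1..r. 1)" by simp
      also have "\<dots> \<le> (\<Sum>j=1..r. \<Sum>x\<in>F j. Poly_Mapping.lookup d x)"
        using d(1) by (intro sum_mono) (auto simp: weak_cover_def facets_\<Gamma>)
      also have "\<dots> = (\<Sum>j=1..r. Poly_Mapping.lookup d (i j) + Poly_Mapping.lookup d (i (j + 1)))"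
        using F_sum[OF d(2)] by (intro sum.cong) auto
      also have "\<dots> = 2 * (\<Sum>j=1..r. Poly_Mapping.lookup d (i j))"
        by (simp only: sum.distrib shift mult_2)
      also have "(\<Sum>j=1..r. Poly_Mapping.lookup d (i j)) = (\<Sum>x\<in>I. Poly_Mapping.lookup d x)"
        by (simp only: I_def sum.reindex[OF inj] comp_def)
      finally show ?thesis using \<open>odd r\<close> by (cases "r = 2 * (\<Sum>x\<in>I. Poly_Mapping.lookup d x)") auto
    qed
    have "Poly_Mapping.keys a \<subseteq> I" "Poly_Mapping.keys b \<subseteq> I"
      using c_eq by (fastforce simp: lookup_c in_keys_iff split: if_splits)+
    then have "r < 2 * (\<Sum>x\<in>I. Poly_Mapping.lookup a x)" "r < 2 * (\<Sum>x\<in>I. Poly_Mapping.lookup b x)"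
      using large ds(2) ab by auto
    moreover have "(\<Sum>x\<in>I. Poly_Mapping.lookup a x) + (\<Sum>x\<in>I. Poly_Mapping.lookup b x) \<le> (\<Sum>x\<in>I. Poly_Mapping.lookup c x)"
      unfolding sum.distrib[symmetric] using c_eq by (intro sum_mono) simp
    moreover have "(\<Sum>x\<in>I. Poly_Mapping.lookup c x) = r" using \<open>card I = r\<close> by (simp add: lookup_c)
    ultimately show False by linarith
  qed
  ultimately show ?thesis using sub by blast
qed

theorem theorem2p5:
  fixes n :: nat and \<Delta> :: "nat set set"
  assumes "simplicial_complex n \<Delta>"
  shows "((\<forall>\<Gamma>. subcomplex n \<Gamma> \<Delta> \<longrightarrow>
             standard_graded n (squarefree_cover_algebra n \<Gamma> :: 'k::field mpoly poly set))
          \<longleftrightarrow>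
          (\<forall>\<Gamma>. subcomplex n \<Gamma> \<Delta> \<longrightarrow>
             standard_graded n (vertex_cover_algebra n \<Gamma> :: 'k mpoly poly set)))
       \<and> ((\<forall>\<Gamma>. subcomplex n \<Gamma> \<Delta> \<longrightarrow>
             standard_graded n (vertex_cover_algebra n \<Gamma> :: 'k mpoly poly set))
          \<longleftrightarrow>
          \<not> (\<exists>r i F. odd r \<and> special_cycle n \<Delta> r i F))"
proof -
  let ?no = "\<not> (\<exists>r i F. odd r \<and> special_cycle n \<Delta> r i F)"
  have dec: "decomposable n \<Gamma> k c"
    if ?no "subcomplex n \<Gamma> \<Delta>" "weak_cover n \<Gamma> k c" for \<Gamma> k c
    using weak_cover_decomposable that balanced_facets[OF assms that(1)]
    by (auto simp: subcomplex_def)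
  have A: "standard_graded n (vertex_cover_algebra n \<Gamma> :: 'k mpoly poly set)"
    and B: "standard_graded n (squarefree_cover_algebra n \<Gamma> :: 'k mpoly poly set)"
    if ?no "subcomplex n \<Gamma> \<Delta>" for \<Gamma>
  proof -
    have "simplicial_complex n \<Gamma>" using that(2) by (simp add: subcomplex_def)
    then show "standard_graded n (vertex_cover_algebra n \<Gamma> :: 'k mpoly poly set)"
      "standard_graded n (squarefree_cover_algebra n \<Gamma> :: 'k mpoly poly set)"
      using standard_graded_vertex_cover_algebra standard_graded_squarefree_cover_algebra dec[OF that]
      by blast+
  qed
  \<comment> \<open>For \<open>A\<close> and \<open>B\<close> alike: any algebra between the two contains the monomial of the indecomposable
    cover, and its part of degree one consists of elements of \<open>A\<close>.\<close>
  have no: ?no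
    if std: "\<And>\<Gamma>. subcomplex n \<Gamma> \<Delta> \<Longrightarrow> standard_graded n (R \<Gamma> :: 'k mpoly poly set)"
      and R: "\<And>\<Gamma>. subcomplex n \<Gamma> \<Delta> \<Longrightarrow> squarefree_cover_algebra n \<Gamma> \<subseteq> R \<Gamma> \<and> R \<Gamma> \<subseteq> vertex_cover_algebra n \<Gamma>"
    for R
  proof (rule notI, elim exE conjE)
    fix r i F assume "odd r" "special_cycle n \<Delta> r i F"
    then obtain \<Gamma> c where \<Gamma>: "subcomplex n \<Gamma> \<Delta>" and c: "squarefree_cover n \<Gamma> 2 c" "\<not> decomposable n \<Gamma> 2 c"
      using odd_special_cycle_indecomposable[OF assms] by blast
    then have complex: "simplicial_complex n \<Gamma>" by (simp add: subcomplex_def)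
    have "monom (xpow c) 2 \<in> (squarefree_cover_algebra n \<Gamma> :: 'k mpoly poly set)"
      unfolding squarefree_cover_algebra_def
      by (rule hull_inc, rule CollectI, rule exI[of _ c], rule exI[of _ 2]) (simp add: c(1))
    then have "monom (xpow c) 2 \<in> R \<Gamma>" using R[OF \<Gamma>] by blast
    also have "R \<Gamma> = S_subalgebra n hull {f \<in> R \<Gamma>. \<exists>s. f = monom s 1}"
      using std[OF \<Gamma>] by (simp add: standard_graded_def)
    also have "\<dots> \<subseteq> S_subalgebra n hull {f \<in> vertex_cover_algebra n \<Gamma>. \<exists>s. f = monom s 1}"
      by (rule hull_mono) (use R[OF \<Gamma>] in auto)
    also have "\<dots> \<subseteq> monomial_algebra (decomposable n \<Gamma>)"
      by (rule hull_degree_one_vertex_cover_algebra[OF complex])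
    finally show False using c(2) by (simp add: monom_xpow_in_monomial_algebra)
  qed
  have BA: "squarefree_cover_algebra n \<Gamma> \<subseteq> (vertex_cover_algebra n \<Gamma> :: 'k mpoly poly set)"
    if "subcomplex n \<Gamma> \<Delta>" for \<Gamma>
    using that squarefree_cover_algebra_subset by (auto simp: subcomplex_def)
  show ?thesis
    using A B no[of "vertex_cover_algebra n"] no[of "squarefree_cover_algebra n"] BA by blast
qed

end
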